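(* Let $n,r$ be positive integers with $\gcd(r,n)=1$, let $G_r=2^r+1$, and let $e$ be the least positive residue of the inverse of $r$ modulo $n$. Let $a\in\{1,\dots,2^n-2\}$ and let $(a_0,\dots,a_{n-1})\in\{0,1\}^n$ be given by $a_i=\alpha_{(-ir)\bmod n}$, where $a=\sum_{m=0}^{n-1}\alpha_m2^m$ is the binary expansion (so $a\equiv\sum_{i=0}^{n-1}a_i2^{-ir}\pmod{2^n-1}$). The following are equivalent: (a) $a$ is the inverse of $G_r$ modulo $2^n-1$; (b) there exists a sequence $(c_0,\dots,c_{n-1})$ with $c_i\in\{0,1\}$ such that $$2c_0-c_e+1=a_1+a_0,\qquad 2c_i-c_{i+e}=a_{i+1}+a_i\ \text{ for all } i\in\mathbb{Z}_n,\ i\ne0,$$ where indices are taken modulo $n$. Moreover, the sequence $c$ in (b) is unique.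
   Context: Powers $2^{m}$ with arbitrary integer $m$ are understood modulo $2^n-1$, i.e. $2^m=2^{m\bmod n}$. *)

theory Defs
  imports Complex_Main "HOL-Library.FuncSet" "HOL-Number_Theory.Cong"
begin

definition G :: "nat \<Rightarrow> int" where
  "G r = 2 ^ r + 1"

text \<open>For \<open>n = 1\<close> the least positive residue is \<open>1\<close>, not \<open>0\<close>.\<close>

definition inv_residue :: "nat \<Rightarrow> nat \<Rightarrow> nat" where
  "inv_residue r n = (LEAST e. 0 < e \<and> [r * e = 1] (mod n))"

text \<open>
  Sequences indexed by the integers modulo \<open>n\<close> are functions on \<open>{..<n}\<close>. The carry sequence is
  made extensional so that two carry sequences are equal as functions exactly if they agree on
  \<open>{..<n}\<close>.
\<close>

definition carry_sequence :: "nat \<Rightarrow> nat \<Rightarrow> (nat \<Rightarrow> int) \<Rightarrow> (nat \<Rightarrow> int) \<Rightarrow> bool" where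
  "carry_sequence n e d c \<longleftrightarrow>
     c \<in> {..<n} \<rightarrow>\<^sub>E {0, 1} \<and>
     2 * c 0 - c (e mod n) + 1 = d (1 mod n) + d 0 \<and>
     (\<forall>i\<in>{..<n} - {0}. 2 * c i - c ((i + e) mod n) = d ((i + 1) mod n) + d i)"

end

theory Submission imports Defs begin

text \<open>
  Put \<open>m(i) = (-ir) mod n\<close>, a permutation of \<open>{..<n}\<close> that turns the shift \<open>i \<mapsto> i + e\<close> into
  \<open>m \<mapsto> m - 1\<close> and \<open>i \<mapsto> i + 1\<close> into \<open>m \<mapsto> m - r\<close>. Hence the digits \<open>s\<^sub>i = a\<^sub>i\<^sub>+\<^sub>1 + a\<^sub>i\<close>, weighted by
  \<open>2^m(i)\<close>, sum to a number congruent to \<open>a G\<^sub>r\<close>, and \<open>c\<close> is the sequence of carries that normalises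
  these digits to the expansion of 1. Summing the carry equations telescopes modulo \<open>2^n - 1\<close>.
  Conversely \<open>a G\<^sub>r \<equiv> 1\<close> makes that sum equal to \<open>1 + k(2^n - 1)\<close> with \<open>k \<in> {0, 1}\<close>, and adding with
  incoming carry \<open>k\<close> produces the outgoing carry \<open>k\<close>. Uniqueness is a parity argument: the
  difference of two solutions satisfies \<open>2\<delta>\<^sub>i = \<delta>\<^sub>i\<^sub>+\<^sub>e \<in> {-1, 0, 1}\<close>.
\<close>

section \<open>Congruences and cyclic sums\<close>

lemma inv_residue_cong:
  assumes "0 < n" "gcd r n = 1"
  shows "[r * inv_residue r n = 1] (mod n)"
proof -
  obtain x where x: "[r * x = 1] (mod n)"
    using cong_solve_coprime_nat[of r n] assms by (auto simp: coprime_iff_gcd_eq_1)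
  \<comment> \<open>\<open>x\<close> may be 0 when \<open>n = 1\<close>; adding \<open>n\<close>
    makes it positive and keeps its residue.\<close>
  have "[r * (x + n) = 1] (mod n)"
    using x by (simp add: cong_def distrib_left)
  then have "0 < x + n \<and> [r * (x + n) = 1] (mod n)"
    using assms by simp
  then show ?thesis
    unfolding inv_residue_def by (rule LeastI2) simp
qed

lemma sum_shift_mod:
  fixes g :: "nat \<Rightarrow> 'a::comm_monoid_add"
  assumes "0 < n"
  shows "(\<Sum>i<n. g ((i + k) mod n)) = (\<Sum>i<n. g i)"
proof -
  have "inj_on (\<lambda>i. (i + k) mod n) {..<n}"
    by (rule inj_onI) (metis cong_add_rcancel_nat cong_def lessThan_iff mod_less)
  then have "bij_betw (\<lambda>i. (i + k) mod n) {..<n} {..<n}"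
    using assms by (intro bij_betw_imageI endo_inj_surj) auto
  then show ?thesis
    by (rule sum.reindex_bij_betw)
qed

lemma cong_two_power_mod:
  assumes "[x = y] (mod n)"
  shows "[(2::int) ^ x = 2 ^ y] (mod (2 ^ n - 1))"
proof -
  have "[(2::int) ^ z = 2 ^ (z mod n)] (mod (2 ^ n - 1))" for z
  proof -
    have "[(2::int) ^ n = 1] (mod (2 ^ n - 1))"
      by (simp add: cong_iff_dvd_diff)
    then have "[((2::int) ^ n) ^ (z div n) * 2 ^ (z mod n) = 1 ^ (z div n) * 2 ^ (z mod n)] (mod (2 ^ n - 1))"
      by (intro cong_mult cong_pow cong_refl)
    then show ?thesis
      by (simp flip: power_mult power_add)
  qed
  from this[of x] this[of y] assms show ?thesis
    by (metis cong_def)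
qed

section \<open>Carries in binary addition\<close>

lemma sum_two_power: "(\<Sum>j<n. (2::int) ^ j) = 2 ^ n - 1"
  by (induction n) auto

text \<open>\<open>f j\<close> is the carry into position \<open>j\<close>. The target value 1 is
  subtracted in advance, hence \<open>f 0 = k - 1\<close>; every output bit is then 0, each halving
  is exact, and \<open>total\<close> leaves \<open>k\<close> as the last carry.\<close>

lemma carries_exist:
  fixes \<sigma> :: "nat \<Rightarrow> int"
  assumes \<sigma>: "\<And>j. j < n \<Longrightarrow> 0 \<le> \<sigma> j \<and> \<sigma> j \<le> 2"
    and k: "k \<in> {0, 1}"
    and total: "(\<Sum>j<n. \<sigma> j * 2 ^ j) = 1 + k * (2 ^ n - 1)"
  obtains f :: "nat \<Rightarrow> int"
  where "f 0 = k - 1" "f n = k" "\<And>j. j < n \<Longrightarrow> f (Suc j) \<in> {0, 1}"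
    "\<And>j. j < n \<Longrightarrow> 2 * f (Suc j) = f j + \<sigma> j"
proof
  define S where "S j = (\<Sum>i<j. \<sigma> i * 2 ^ i) + k - 1" for j
  define f where "f j = S j div 2 ^ j" for j
  have S_n: "S n = k * 2 ^ n"
    using total by (simp add: S_def algebra_simps)
  \<comment> \<open>\<open>S n\<close> and all terms from position \<open>j\<close> on are multiples
    of \<open>2 ^ j\<close>, hence so is \<open>S j\<close>.\<close>
  have "2 ^ j dvd S j" if "j \<le> n" for j
  proof -
    have "S n = S j + (\<Sum>i=j..<n. \<sigma> i * 2 ^ i)"
      using that by (simp add: S_def lessThan_atLeast0 sum.atLeastLessThan_concat)
    moreover have "2 ^ j dvd (\<Sum>i=j..<n. \<sigma> i * 2 ^ i)"
      by (intro dvd_sum dvd_mult le_imp_power_dvd) auto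
    moreover have "2 ^ j dvd S n"
      using that unfolding S_n by (intro dvd_mult le_imp_power_dvd)
    ultimately show ?thesis
      by (metis dvd_add_left_iff)
  qed
  then have f: "f j * 2 ^ j = S j" if "j \<le> n" for j
    using that by (simp add: f_def)
  show "f 0 = k - 1"
    by (simp add: f_def S_def)
  show "f n = k"
    by (simp add: f_def S_n)
  fix j assume j: "j < n"
  have "2 ^ j * (2 * f (Suc j)) = 2 ^ j * (f j + \<sigma> j)"
    using f[of j] f[of "Suc j"] j by (simp add: S_def algebra_simps)
  then show "2 * f (Suc j) = f j + \<sigma> j"
    by simp
  have "(\<Sum>i<Suc j. \<sigma> i * 2 ^ i) \<le> (\<Sum>i<Suc j. 2 * 2 ^ i)"
    using \<sigma> j by (intro sum_mono mult_right_mono) auto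
  also have "\<dots> = 2 * 2 ^ Suc j - 2"
    using sum_two_power[of "Suc j"] by (simp flip: sum_distrib_left)
  finally have "S (Suc j) < 2 * 2 ^ Suc j"
    using k unfolding S_def by auto
  then have "f (Suc j) * 2 ^ Suc j < 2 * 2 ^ Suc j"
    using f[of "Suc j"] j by simp
  then have less: "f (Suc j) < 2"
    by (rule mult_right_less_imp_less) simp
  have "0 \<le> (\<Sum>i<Suc j. \<sigma> i * 2 ^ i)"
    using \<sigma> j by (intro sum_nonneg mult_nonneg_nonneg) auto
  then have "-1 \<le> S (Suc j)"
    using k unfolding S_def by auto
  \<comment> \<open>The positive exponent makes the lower bound strict; at \<open>f 0\<close> the
    value -1 does occur, for \<open>k = 0\<close>.\<close>
  moreover have "(1::int) < 2 ^ Suc j"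
    by (rule one_less_power) auto
  ultimately have "(-1) * 2 ^ Suc j < f (Suc j) * 2 ^ Suc j"
    using f[of "Suc j"] j by simp
  then have "-1 < f (Suc j)"
    by (rule mult_right_less_imp_less) simp
  with less show "f (Suc j) \<in> {0, 1}"
    by auto
qed

section \<open>The permutation of bit positions\<close>

definition bit_pos :: "nat \<Rightarrow> nat \<Rightarrow> nat \<Rightarrow> nat" where
  "bit_pos n r i = nat ((- int i * int r) mod int n)"

lemma bit_pos_less: "0 < n \<Longrightarrow> bit_pos n r i < n"
  by (simp add: bit_pos_def nat_less_iff)

lemma bit_pos_0 [simp]: "bit_pos n r 0 = 0"
  by (simp add: bit_pos_def)

lemma int_bit_pos: "0 < n \<Longrightarrow> int (bit_pos n r i) = (- int i * int r) mod int n"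
  by (simp add: bit_pos_def)

text \<open>Written additively to avoid subtraction on \<open>nat\<close>. Modulo \<open>n\<close>,
  \<open>k = 1\<close> lowers the position by \<open>r\<close>, and \<open>k = e\<close> lowers it
  by 1.\<close>

lemma bit_pos_shift:
  assumes "0 < n"
  shows "[bit_pos n r ((i + k) mod n) + r * k = bit_pos n r i] (mod n)"
proof -
  have "[int (bit_pos n r ((i + k) mod n)) + int (r * k)
      = - int ((i + k) mod n) * int r + int (r * k)] (mod int n)"
    using assms by (intro cong_add cong_refl) (simp add: int_bit_pos cong_def)
  also have "[- int ((i + k) mod n) * int r + int (r * k)
      = - int (i + k) * int r + int (r * k)] (mod int n)"
    by (intro cong_add cong_mult cong_refl) (simp only: cong_minus_minus_iff cong_int_iff cong_mod_left cong_refl)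
  also have "- int (i + k) * int r + int (r * k) = - int i * int r"
    by (simp add: algebra_simps)
  also have "[- int i * int r = int (bit_pos n r i)] (mod int n)"
    using assms by (simp add: int_bit_pos cong_def)
  finally show ?thesis
    by (metis cong_int_iff of_nat_add)
qed

text \<open>Cancelling \<open>r\<close> modulo \<open>n\<close> gives injectivity, which suffices on
  a finite set.\<close>

lemma bij_betw_bit_pos:
  assumes "0 < n" "gcd r n = 1"
  shows "bij_betw (bit_pos n r) {..<n} {..<n}"
proof -
  have "inj_on (bit_pos n r) {..<n}"
  proof (rule inj_onI)
    fix i j assume ij: "i \<in> {..<n}" "j \<in> {..<n}" and "bit_pos n r i = bit_pos n r j"
    then have "[- (int i * int r) = - (int j * int r)] (mod int n)"
      using assms by (metis int_bit_pos cong_def minus_mult_left)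
    then have "[int (i * r) = int (j * r)] (mod int n)"
      by (simp add: cong_minus_minus_iff)
    then have "[i * r = j * r] (mod n)"
      by (simp only: cong_int_iff)
    then have "[i = j] (mod n)"
      using assms by (simp add: cong_mult_rcancel_nat coprime_iff_gcd_eq_1)
    then show "i = j"
      using ij by (simp add: cong_def)
  qed
  then show ?thesis
    using assms by (intro bij_betw_imageI endo_inj_surj) (auto simp: bit_pos_less)
qed

text \<open>Rewriting the weights by \<open>bit_pos_shift\<close> and reindexing the cyclic sum
  turns the shift into a factor: \<open>2 ^ r\<close> for \<open>k = 1\<close>, and 2 for
  \<open>k = e\<close>.\<close>

lemma sum_shift_bit_pos_cong:
  fixes g :: "nat \<Rightarrow> int"
  assumes "0 < n"
  shows "[(\<Sum>i<n. g ((i + k) mod n) * 2 ^ bit_pos n r i)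
    = 2 ^ (r * k) * (\<Sum>i<n. g i * 2 ^ bit_pos n r i)] (mod (2 ^ n - 1))"
proof -
  have "[(\<Sum>i<n. g ((i + k) mod n) * 2 ^ bit_pos n r i)
      = (\<Sum>i<n. g ((i + k) mod n) * 2 ^ (bit_pos n r ((i + k) mod n) + r * k))] (mod (2 ^ n - 1))"
    using bit_pos_shift[OF assms]
    by (intro cong_sum cong_mult cong_refl cong_two_power_mod) (simp add: cong_sym)
  also have "(\<Sum>i<n. g ((i + k) mod n) * 2 ^ (bit_pos n r ((i + k) mod n) + r * k))
      = (\<Sum>i<n. g i * 2 ^ (bit_pos n r i + r * k))"
    using assms by (rule sum_shift_mod)
  also have "\<dots> = 2 ^ (r * k) * (\<Sum>i<n. g i * 2 ^ bit_pos n r i)"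
    by (simp add: sum_distrib_left power_add mult_ac)
  finally show ?thesis .
qed

lemma sum_digits_bit_pos_cong:
  fixes d :: "nat \<Rightarrow> int"
  assumes "0 < n"
  shows "[(\<Sum>i<n. (d ((i + 1) mod n) + d i) * 2 ^ bit_pos n r i)
    = (\<Sum>i<n. d i * 2 ^ bit_pos n r i) * G r] (mod (2 ^ n - 1))"
proof -
  have "[(\<Sum>i<n. d ((i + 1) mod n) * 2 ^ bit_pos n r i) + (\<Sum>i<n. d i * 2 ^ bit_pos n r i)
      = 2 ^ (r * 1) * (\<Sum>i<n. d i * 2 ^ bit_pos n r i) + (\<Sum>i<n. d i * 2 ^ bit_pos n r i)]
      (mod (2 ^ n - 1))"
    by (intro cong_add cong_refl sum_shift_bit_pos_cong assms)
  then show ?thesis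
    by (simp add: G_def distrib_left distrib_right sum.distrib mult.commute)
qed

section \<open>Carry sequences and the inverse of \<open>G r\<close>\<close>

lemma carry_sequence_unique:
  assumes c: "carry_sequence n e d c" and c': "carry_sequence n e d c'"
  shows "c = c'"
proof (rule PiE_ext)
  show "c \<in> {..<n} \<rightarrow>\<^sub>E {0, 1}" "c' \<in> {..<n} \<rightarrow>\<^sub>E {0, 1}"
    using c c' by (simp_all add: carry_sequence_def)
  fix i assume i: "i \<in> {..<n}"
  \<comment> \<open>The extra 1 at \<open>i = 0\<close> cancels in the difference.\<close>
  have "2 * (c i - c' i) = c ((i + e) mod n) - c' ((i + e) mod n)"
    using c c' i by (cases "i = 0") (force simp: carry_sequence_def)+
  moreover have "c ((i + e) mod n) \<in> {0, 1}" "c' ((i + e) mod n) \<in> {0, 1}"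
    using c c' i by (auto simp: carry_sequence_def PiE_iff)
  ultimately show "c i = c' i"
    by auto
qed

lemma carry_sequence_imp_cong:
  assumes n: "0 < n" and re: "[r * e = 1] (mod n)" and c: "carry_sequence n e d c"
  shows "[(\<Sum>i<n. d i * 2 ^ bit_pos n r i) * G r = 1] (mod (2 ^ n - 1))"
proof -
  let ?w = "\<lambda>i. (2::int) ^ bit_pos n r i"
  have "(d ((i + 1) mod n) + d i) * ?w i
      = 2 * (c i * ?w i) - c ((i + e) mod n) * ?w i + (if i = 0 then 1 else 0)" if "i < n" for i
  proof -
    have "d ((i + 1) mod n) + d i = 2 * c i - c ((i + e) mod n) + (if i = 0 then 1 else 0)"
      using c that by (auto simp: carry_sequence_def)
    then show ?thesis
      by (simp only:) (auto simp: left_diff_distrib distrib_right)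
  qed
  then have "(\<Sum>i<n. (d ((i + 1) mod n) + d i) * ?w i)
      = (\<Sum>i<n. 2 * (c i * ?w i) - c ((i + e) mod n) * ?w i + (if i = 0 then 1 else 0))"
    by (intro sum.cong) auto
  also have "\<dots> = 2 ^ 1 * (\<Sum>i<n. c i * ?w i) - (\<Sum>i<n. c ((i + e) mod n) * ?w i) + 1"
    using n by (simp add: sum.distrib sum_subtractf sum_distrib_left)
  \<comment> \<open>Doubling and shifting by \<open>e\<close> contribute the same factor, so the
    carry sums cancel and 1 remains.\<close>
  also have "[\<dots> = 2 ^ (r * e) * (\<Sum>i<n. c i * ?w i) - 2 ^ (r * e) * (\<Sum>i<n. c i * ?w i) + 1]
      (mod (2 ^ n - 1))"
    using re
    by (intro cong_add cong_diff cong_mult cong_refl cong_two_power_mod sum_shift_bit_pos_cong n)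
      (simp add: cong_sym)
  finally show ?thesis
    using sum_digits_bit_pos_cong[OF n, of d r] by (simp add: cong_def)
qed

lemma cong_imp_carry_sequence:
  assumes n: "0 < n" and r: "gcd r n = 1" and re: "[r * e = 1] (mod n)"
    and d: "\<And>i. i < n \<Longrightarrow> d i \<in> {0, 1}"
    and a: "a = (\<Sum>i<n. d i * 2 ^ bit_pos n r i)" "1 \<le> a" "a \<le> 2 ^ n - 2"
    and cong: "[a * G r = 1] (mod (2 ^ n - 1))"
  shows "\<exists>c. carry_sequence n e d c"
proof -
  define s where "s i = d ((i + 1) mod n) + d i" for i
  \<comment> \<open>The digit sums, now indexed by bit position.\<close>
  define \<sigma> where "\<sigma> = s \<circ> inv_into {..<n} (bit_pos n r)"
  \<comment> \<open>The bits of \<open>a\<close> rotated: a representative of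
    \<open>2 ^ r * a\<close> between 0 and \<open>2 ^ n - 1\<close>.\<close>
  define b where "b = (\<Sum>i<n. d ((i + 1) mod n) * 2 ^ bit_pos n r i)"
  have bij: "bij_betw (bit_pos n r) {..<n} {..<n}"
    using n r by (rule bij_betw_bit_pos)
  have \<sigma>_bit_pos: "\<sigma> (bit_pos n r i) = s i" if "i < n" for i
    using bij that by (simp add: \<sigma>_def bij_betw_inv_into_left)
  have d_shift: "d ((i + 1) mod n) \<in> {0, 1}" for i
    using d n by simp
  have "(\<Sum>j<n. \<sigma> j * 2 ^ j) = (\<Sum>i<n. \<sigma> (bit_pos n r i) * 2 ^ bit_pos n r i)"
    by (rule sum.reindex_bij_betw[OF bij, symmetric])
  also have "\<dots> = (\<Sum>i<n. s i * 2 ^ bit_pos n r i)"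
    by (simp add: \<sigma>_bit_pos)
  finally have \<sigma>_sum: "(\<Sum>j<n. \<sigma> j * 2 ^ j) = (\<Sum>i<n. s i * 2 ^ bit_pos n r i)" .
  also have "\<dots> = b + a"
    by (simp add: s_def b_def a(1) distrib_right sum.distrib)
  finally have \<sigma>_ab: "(\<Sum>j<n. \<sigma> j * 2 ^ j) = b + a" .
  have "[(\<Sum>i<n. s i * 2 ^ bit_pos n r i) = a * G r] (mod (2 ^ n - 1))"
    unfolding s_def a(1) by (rule sum_digits_bit_pos_cong[OF n])
  then have "[b + a = 1] (mod (2 ^ n - 1))"
    using cong unfolding \<sigma>_ab[symmetric] \<sigma>_sum by (rule cong_trans)
  then have "(2 ^ n - 1) dvd (b + a - 1)"
    by (simp add: cong_iff_dvd_diff)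
  then obtain k where k: "b + a - 1 = (2 ^ n - 1) * k" ..
  have "0 \<le> d ((i + 1) mod n)" "d ((i + 1) mod n) \<le> 1" for i
    using d_shift[of i] by auto
  then have "0 \<le> b" "b \<le> (\<Sum>i<n. 1 * 2 ^ bit_pos n r i)"
    unfolding b_def by (auto intro!: sum_nonneg sum_mono mult_right_mono simp del: One_nat_def)
  moreover have "(\<Sum>i<n. (2::int) ^ bit_pos n r i) = 2 ^ n - 1"
    using sum.reindex_bij_betw[OF bij, of "\<lambda>j. (2::int) ^ j"] by (simp add: sum_two_power)
  \<comment> \<open>The bounds on \<open>a\<close> and \<open>b\<close> give
    \<open>0 \<le> b + a - 1 \<le> 2 * (2 ^ n - 1) - 2\<close>.\<close>
  ultimately have "(2 ^ n - 1) * (-1) < (2 ^ n - 1) * k" "(2 ^ n - 1) * k < (2 ^ n - 1) * 2"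
    using a(2,3) k by auto
  moreover have "(0::int) \<le> 2 ^ n - 1"
    by simp
  ultimately have "-1 < k" "k < 2"
    by (blast intro: mult_left_less_imp_less)+
  then have k01: "k \<in> {0, 1}"
    by auto
  have "0 \<le> \<sigma> j \<and> \<sigma> j \<le> 2" if "j < n" for j
  proof -
    obtain i where i: "i < n" "j = bit_pos n r i"
      using bij \<open>j < n\<close> by (auto simp: bij_betw_def image_iff set_eq_iff)
    then show ?thesis
      using d[of i] d_shift[of i] by (auto simp: \<sigma>_bit_pos s_def)
  qed
  moreover have "(\<Sum>j<n. \<sigma> j * 2 ^ j) = 1 + k * (2 ^ n - 1)"
    using k by (simp add: \<sigma>_ab mult.commute)
  ultimately obtain f where f: "f 0 = k - 1" "f n = k" "\<And>j. j < n \<Longrightarrow> f (Suc j) \<in> {0, 1}"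
    "\<And>j. j < n \<Longrightarrow> 2 * f (Suc j) = f j + \<sigma> j"
    using carries_exist[of n \<sigma> k] k01 by blast
  \<comment> \<open>\<open>Suc\<close> selects the carry out of the position of
    \<open>i\<close>.\<close>
  define c where "c = (\<lambda>i\<in>{..<n}. f (Suc (bit_pos n r i)))"
  have step: "2 * c i = f (bit_pos n r i) + s i" if "i < n" for i
    using f(4)[OF bit_pos_less[OF n]] that by (simp add: c_def \<sigma>_bit_pos)
  \<comment> \<open>Index \<open>i + e\<close> belongs to the preceding position, whose outgoing
    carry enters the position of \<open>i\<close>.\<close>
  have shift: "[Suc (bit_pos n r ((i + e) mod n)) = bit_pos n r i] (mod n)" for i
  proof -
    have "[bit_pos n r ((i + e) mod n) + 1 = bit_pos n r ((i + e) mod n) + r * e] (mod n)"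
      using re by (intro cong_add cong_refl) (rule cong_sym)
    then show ?thesis
      using bit_pos_shift[OF n, of r i e] by (auto dest: cong_trans)
  qed
  \<comment> \<open>Position 0 is preceded cyclically by \<open>n - 1\<close>, with outgoing carry
    \<open>f n = k\<close>. Since \<open>f 0 = k - 1\<close>, this produces the extra 1 in the
    equation at index 0.\<close>
  have prev_0: "c (e mod n) = k"
  proof -
    have "n dvd Suc (bit_pos n r (e mod n))"
      using shift[of 0] by (simp add: cong_0_iff)
    then have "Suc (bit_pos n r (e mod n)) = n"
      using bit_pos_less[OF n, of r "e mod n"] by (auto dest: dvd_imp_le)
    then show ?thesis
      using n by (simp add: c_def f(2))
  qed
  \<comment> \<open>Away from position 0 there is no wrap-around.\<close>
  have prev: "c ((i + e) mod n) = f (bit_pos n r i)" if "i < n" "i \<noteq> 0" for i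
  proof -
    have "bit_pos n r i \<noteq> 0"
      using bij that n by (metis bij_betw_imp_inj_on bit_pos_0 inj_onD lessThan_iff)
    moreover have "Suc (bit_pos n r ((i + e) mod n)) mod n = bit_pos n r i"
      using shift[of i] bit_pos_less[OF n, of r i] by (simp add: cong_def)
    ultimately have "Suc (bit_pos n r ((i + e) mod n)) = bit_pos n r i"
      using bit_pos_less[OF n, of r "(i + e) mod n"] by (auto simp: mod_Suc split: if_splits)
    then show ?thesis
      using n by (simp add: c_def)
  qed
  have "c \<in> {..<n} \<rightarrow>\<^sub>E {0, 1}"
    using f(3)[OF bit_pos_less[OF n]] by (auto simp: c_def)
  moreover have "2 * c 0 - c (e mod n) + 1 = d (1 mod n) + d 0"
    using step[of 0] n f(1) prev_0 by (simp add: s_def)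
  moreover have "2 * c i - c ((i + e) mod n) = d ((i + 1) mod n) + d i" if "i \<in> {..<n} - {0}" for i
    using step[of i] prev[of i] that by (simp add: s_def)
  ultimately show ?thesis
    unfolding carry_sequence_def by blast
qed

theorem theorem3:
  fixes n r e :: nat and a :: int and \<alpha> d :: "nat \<Rightarrow> int"
  assumes "0 < n" and "0 < r" and "gcd r n = 1"
    and "e = inv_residue r n"
    and "a \<in> {1..2 ^ n - 2}"
    and "\<forall>m<n. \<alpha> m \<in> {0, 1}" and "a = (\<Sum>m<n. \<alpha> m * 2 ^ m)"
    and "\<forall>i<n. d i = \<alpha> (nat ((- int i * int r) mod int n))"
  shows "([a * G r = 1] (mod (2 ^ n - 1)) \<longleftrightarrow> (\<exists>c. carry_sequence n e d c)) \<and>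
         (\<forall>c c'. carry_sequence n e d c \<and> carry_sequence n e d c' \<longrightarrow> c = c')"
proof -
  have re: "[r * e = 1] (mod n)"
    using assms inv_residue_cong by simp
  have d_eq: "d i = \<alpha> (bit_pos n r i)" if "i < n" for i
    using assms(8) that by (simp add: bit_pos_def)
  \<comment> \<open>The binary expansion reordered along \<open>bit_pos\<close>.\<close>
  have "a = (\<Sum>i<n. \<alpha> (bit_pos n r i) * 2 ^ bit_pos n r i)"
    using sum.reindex_bij_betw[OF bij_betw_bit_pos[OF assms(1,3)], of "\<lambda>m. \<alpha> m * 2 ^ m"] assms(7)
    by simp
  also have "\<dots> = (\<Sum>i<n. d i * 2 ^ bit_pos n r i)"
    by (simp add: d_eq)
  finally have a: "a = (\<Sum>i<n. d i * 2 ^ bit_pos n r i)" .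
  have "d i \<in> {0, 1}" if "i < n" for i
    using assms(6) bit_pos_less[OF assms(1)] by (simp add: d_eq[OF that])
  then have "\<exists>c. carry_sequence n e d c" if "[a * G r = 1] (mod (2 ^ n - 1))"
    using cong_imp_carry_sequence[OF assms(1,3) re _ a _ _ that] assms(5) by auto
  moreover have "[a * G r = 1] (mod (2 ^ n - 1))" if "carry_sequence n e d c" for c
    using carry_sequence_imp_cong[OF assms(1) re that] a by simp
  ultimately show ?thesis
    using carry_sequence_unique by blast
qed

end
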